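(* Let $\Delta$ be a flag homology sphere (over a field $\mathbb{F}$), and let $G$ be the complement of the $1$-skeleton of $\Delta$ (same vertex set; two vertices adjacent in $G$ iff they do not form an edge of $\Delta$). Then $G$ has a half-integral perfect matching; equivalently, the vertex set of $G$ can be partitioned into (the vertex sets of) edges of a matching of $G$ and odd cycles of $G$.
   Context: A simplicial complex is flag if its faces are exactly the cliques of its $1$-skeleton. $\Delta$ is a homology sphere over $\mathbb{F}$ if for every face $\sigma$ (including $\emptyset$), $\widetilde H_i(\mathrm{lk}_\sigma\Delta;\mathbb{F})=0$ for $i<\dim\Delta-|\sigma|$ and $\cong\mathbb{F}$ for $i=\dim\Delta-|\sigma|$, where $\mathrm{lk}_\sigma\Delta=\{\tau\in\Delta:\tau\cap\sigma=\emptyset,\ \tau\cup\sigma\in\Delta\}$. A half-integral perfect matching of a graph $G$ is a function $f:E(G)\to\{0,\tfrac12,1\}$ with $\sum_{e\ni v}f(e)=1$ for every vertex $v$. *)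

theory Defs
  imports Complex_Main "HOL-Library.Disjoint_Sets" "HOL-Combinatorics.Permutations"
begin

section \<open>Simplicial complexes\<close>

definition simplicial_complex :: "'a set set \<Rightarrow> bool" where
  "simplicial_complex \<Delta> \<longleftrightarrow>
     finite \<Delta> \<and> {} \<in> \<Delta> \<and> (\<forall>\<sigma>\<in>\<Delta>. finite \<sigma>) \<and> (\<forall>\<sigma>\<in>\<Delta>. \<forall>\<tau>. \<tau> \<subseteq> \<sigma> \<longrightarrow> \<tau> \<in> \<Delta>)"

definition vertices :: "'a set set \<Rightarrow> 'a set" where
  "vertices \<Delta> = \<Union>\<Delta>"

definition complex_dim :: "'a set set \<Rightarrow> int" where
  "complex_dim \<Delta> = int (Max (card ` \<Delta>)) - 1"

definition link :: "'a set set \<Rightarrow> 'a set \<Rightarrow> 'a set set" where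
  "link \<Delta> \<sigma> = {\<tau> \<in> \<Delta>. \<tau> \<inter> \<sigma> = {} \<and> \<tau> \<union> \<sigma> \<in> \<Delta>}"

text \<open>Graphs are given by a vertex set and a set of two-element edges.\<close>

definition skeleton_edges :: "'a set set \<Rightarrow> 'a set set" where
  "skeleton_edges \<Delta> = {e \<in> \<Delta>. card e = 2}"

definition clique :: "'a set \<Rightarrow> 'a set set \<Rightarrow> 'a set \<Rightarrow> bool" where
  "clique V E \<sigma> \<longleftrightarrow> \<sigma> \<subseteq> V \<and> (\<forall>u\<in>\<sigma>. \<forall>v\<in>\<sigma>. u \<noteq> v \<longrightarrow> {u, v} \<in> E)"

definition flag :: "'a set set \<Rightarrow> bool" where
  "flag \<Delta> \<longleftrightarrow> \<Delta> = {\<sigma>. clique (vertices \<Delta>) (skeleton_edges \<Delta>) \<sigma>}"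

section \<open>Reduced simplicial homology with coefficients in a field\<close>

text \<open>
  Oriented simplicial chains: a chain of degree \<open>i\<close> assigns a coefficient to every ordering of
  every face with \<open>i + 1\<close> vertices, and reordering the vertices multiplies the coefficient by the
  sign of the permutation. The list \<open>xs\<close> stands for the oriented simplex \<open>[xs]\<close>. No order on the
  vertices has to be chosen. The empty list spans degree \<open>-1\<close>, so the homology is reduced.
\<close>

definition oriented_chains :: "'a set set \<Rightarrow> int \<Rightarrow> ('a list \<Rightarrow> 'k::field) set" where
  "oriented_chains K i = {c.
     (\<forall>xs. c xs \<noteq> 0 \<longrightarrow> distinct xs \<and> set xs \<in> K \<and> int (length xs) = i + 1) \<and>
     (\<forall>xs p. p permutes {..<length xs} \<longrightarrow> c (permute_list p xs) = of_int (sign p) * c xs)}"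

text \<open>
  This is the usual boundary map, sending \<open>[x\<^sub>0, \<dots>, x\<^sub>i]\<close> to the alternating sum of the simplices
  with \<open>x\<^sub>j\<close> omitted: the oriented simplices with \<open>[ys]\<close> in their boundary are, up to sign, the
  \<open>[x # ys]\<close>, and in the boundary of \<open>[x # ys]\<close> the coefficient of \<open>[ys]\<close> is \<open>1\<close>.
\<close>

definition boundary :: "'a set set \<Rightarrow> ('a list \<Rightarrow> 'k::field) \<Rightarrow> 'a list \<Rightarrow> 'k" where
  "boundary K c = (\<lambda>ys. \<Sum>x\<in>vertices K. c (x # ys))"

definition cycles :: "'a set set \<Rightarrow> int \<Rightarrow> ('a list \<Rightarrow> 'k::field) set" where
  "cycles K i = {c \<in> oriented_chains K i. boundary K c = (\<lambda>_. 0)}"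

definition boundaries :: "'a set set \<Rightarrow> int \<Rightarrow> ('a list \<Rightarrow> 'k::field) set" where
  "boundaries K i = boundary K ` oriented_chains K (i + 1)"

definition homology_class :: "'a set set \<Rightarrow> int \<Rightarrow> ('a list \<Rightarrow> 'k::field) \<Rightarrow> ('a list \<Rightarrow> 'k) set" where
  "homology_class K i z = {w \<in> cycles K i. (\<lambda>xs. w xs - z xs) \<in> boundaries K i}"

definition reduced_homology :: "'a set set \<Rightarrow> int \<Rightarrow> ('a list \<Rightarrow> 'k::field) set set" where
  "reduced_homology K i = homology_class K i ` cycles K i"

definition homology_zero :: "'k::field itself \<Rightarrow> 'a set set \<Rightarrow> int \<Rightarrow> bool" where
  "homology_zero _ K i \<longleftrightarrow>
     (reduced_homology K i :: ('a list \<Rightarrow> 'k) set set) = {homology_class K i (\<lambda>_. 0)}"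

text \<open>Isomorphic to the coefficient field as a vector space over it:\<close>

definition homology_iso_field :: "'k::field itself \<Rightarrow> 'a set set \<Rightarrow> int \<Rightarrow> bool" where
  "homology_iso_field _ K i \<longleftrightarrow>
     (\<exists>\<phi> :: ('a list \<Rightarrow> 'k) set \<Rightarrow> 'k.
        bij_betw \<phi> (reduced_homology K i) UNIV \<and>
        (\<forall>z\<in>cycles K i. \<forall>w\<in>cycles K i.
           \<phi> (homology_class K i (\<lambda>xs. z xs + w xs)) =
           \<phi> (homology_class K i z) + \<phi> (homology_class K i w)) \<and>
        (\<forall>a. \<forall>z\<in>cycles K i.
           \<phi> (homology_class K i (\<lambda>xs. a * z xs)) = a * \<phi> (homology_class K i z)))"

definition homology_sphere :: "'k::field itself \<Rightarrow> 'a set set \<Rightarrow> bool" where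
  "homology_sphere F \<Delta> \<longleftrightarrow>
     (\<forall>\<sigma>\<in>\<Delta>.
        (\<forall>i < complex_dim \<Delta> - int (card \<sigma>). homology_zero F (link \<Delta> \<sigma>) i) \<and>
        homology_iso_field F (link \<Delta> \<sigma>) (complex_dim \<Delta> - int (card \<sigma>)))"

section \<open>Graphs, matchings and odd cycles\<close>

definition complement_edges :: "'a set \<Rightarrow> 'a set set \<Rightarrow> 'a set set" where
  "complement_edges V E = {e. e \<subseteq> V \<and> card e = 2 \<and> e \<notin> E}"

definition half_integral_perfect_matching ::
    "'a set \<Rightarrow> 'a set set \<Rightarrow> ('a set \<Rightarrow> real) \<Rightarrow> bool" where
  "half_integral_perfect_matching V E f \<longleftrightarrow>
     (\<forall>e\<in>E. f e \<in> {0, 1/2, 1}) \<and> (\<forall>v\<in>V. (\<Sum>e\<in>{e \<in> E. v \<in> e}. f e) = 1)"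

definition matching :: "'a set set \<Rightarrow> 'a set set \<Rightarrow> bool" where
  "matching E M \<longleftrightarrow> M \<subseteq> E \<and> disjoint M"

definition graph_cycle :: "'a set set \<Rightarrow> 'a list \<Rightarrow> bool" where
  "graph_cycle E xs \<longleftrightarrow>
     length xs \<ge> 3 \<and> distinct xs \<and>
     (\<forall>i<length xs. {xs ! i, xs ! (Suc i mod length xs)} \<in> E)"

definition matching_odd_cycle_partition ::
    "'a set \<Rightarrow> 'a set set \<Rightarrow> 'a set set \<Rightarrow> 'a set set \<Rightarrow> bool" where
  "matching_odd_cycle_partition V E M C \<longleftrightarrow>
     matching E M \<and>
     (\<forall>c\<in>C. \<exists>xs. graph_cycle E xs \<and> odd (length xs) \<and> set xs = c) \<and>
     partition_on V (M \<union> C)"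

end

theory Submission
  imports Defs "HOL-Combinatorics.Cycles"
begin

text \<open>
  A cone is acyclic, so the link of a face \<open>\<sigma>\<close> of a flag homology sphere is not a cone over any of
  its vertices \<open>v\<close>; by flagness the link contains a vertex \<open>w \<noteq> v\<close> adjacent to \<open>v\<close> in \<open>G\<close>. Passing
  from \<open>\<sigma>\<close> to \<open>\<sigma> \<union> {v}\<close> therefore gains a new \<open>G\<close>-neighbour, so every face, that is, every
  independent set of \<open>G\<close>, has at least as many \<open>G\<close>-neighbours as elements. By Hall's theorem on the
  bipartite double cover of \<open>G\<close> there is a permutation of the vertices moving each vertex along an
  edge. Giving every step of the permutation weight 1/2 yields the half-integral matching; its even
  cycles split into matching edges and its odd cycles are odd cycles of \<open>G\<close>.
\<close>

section \<open>Hall's marriage theorem\<close>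

text \<open>Strong induction on the index set. If some nonempty proper subfamily is tight, it and
  the rest are matched separately; otherwise every such subfamily has a spare element, so one index
  may take any of its elements.\<close>

lemma hall_marriage:
  assumes "finite I" "\<And>i. i \<in> I \<Longrightarrow> finite (A i)"
    and "\<And>J. J \<subseteq> I \<Longrightarrow> card J \<le> card (\<Union>(A ` J))"
  shows "\<exists>f. inj_on f I \<and> (\<forall>i\<in>I. f i \<in> A i)"
  using assms
proof (induction I arbitrary: A rule: finite_psubset_induct)
  case (psubset I)
  note fin = \<open>finite I\<close> and finA = psubset.prems(1) and hall = psubset.prems(2)
  have finU: "finite (\<Union>(A ` J))" if "J \<subseteq> I" for J
    using that fin finA finite_subset by blast
  consider "I = {}"
    | J where "J \<noteq> {}" "J \<subset> I" "card (\<Union>(A ` J)) = card J"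
    | "I \<noteq> {}" "\<And>J. J \<noteq> {} \<Longrightarrow> J \<subset> I \<Longrightarrow> card J < card (\<Union>(A ` J))"
    by (metis hall order_le_less psubset_imp_subset)
  then show ?case
  proof cases
    case 1
    then show ?thesis by simp
  next
    case (2 J)
    let ?U = "\<Union>(A ` J)"
    have finJ: "finite J" using 2 fin finite_subset by blast
    obtain g where g: "inj_on g J" "\<And>i. i \<in> J \<Longrightarrow> g i \<in> A i"
      using psubset.IH[of J A] 2 finA hall by (metis psubset_imp_subset subset_iff subset_trans)
    \<comment> \<open>Hall's condition survives the deletion of \<open>?U\<close>: apply it to
      \<open>K \<union> J\<close> and cancel the tight set \<open>J\<close>.\<close>
    have "card K \<le> card (\<Union>i\<in>K. A i - ?U)" if K: "K \<subseteq> I - J" for K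
    proof -
      have finK: "finite K" using K fin finite_subset by blast
      have fin1: "finite (\<Union>i\<in>K. A i - ?U)"
        using K finK finA by blast
      have "card K + card J = card (K \<union> J)"
        using K finK finJ by (subst card_Un_disjoint) auto
      also have "\<dots> \<le> card (\<Union>(A ` (K \<union> J)))"
        using K 2 by (intro hall) auto
      also have "\<Union>(A ` (K \<union> J)) = (\<Union>i\<in>K. A i - ?U) \<union> ?U" by auto
      also have "card \<dots> = card (\<Union>i\<in>K. A i - ?U) + card ?U"
        using fin1 finU[of J] 2 by (intro card_Un_disjoint) auto
      finally show ?thesis using 2 by simp
    qed
    moreover have "I - J \<subset> I" using 2 by auto
    ultimately obtain h where h: "inj_on h (I - J)" "\<And>i. i \<in> I - J \<Longrightarrow> h i \<in> A i - ?U"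
      using psubset.IH[of "I - J" "\<lambda>i. A i - ?U"] finA by fastforce
    define f where "f i = (if i \<in> J then g i else h i)" for i
    have "inj_on f I"
    proof -
      have "inj_on f J" "inj_on f (I - J)"
        using g(1) h(1) by (simp_all add: f_def inj_on_def)
      moreover have "f a \<noteq> f b" if "a \<in> J" "b \<in> I - J" for a b
        using g(2)[of a] h(2)[of b] that by (auto simp: f_def)
      ultimately have "inj_on f (J \<union> (I - J))"
        unfolding inj_on_Un by blast
      then show ?thesis using 2(2) by (simp add: Un_absorb1 psubset_imp_subset)
    qed
    moreover have "\<forall>i\<in>I. f i \<in> A i" using g h by (auto simp: f_def)
    ultimately show ?thesis by blast
  next
    case 3
    then obtain i where i: "i \<in> I" by blast
    have "A i \<noteq> {}" using hall[of "{i}"] i by auto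
    then obtain x where x: "x \<in> A i" by blast
    \<comment> \<open>Deleting \<open>x\<close> costs at most one element, which the surplus of the
      proper subfamily \<open>K\<close> covers.\<close>
    have "card K \<le> card (\<Union>j\<in>K. A j - {x})" if K: "K \<subseteq> I - {i}" for K
    proof (cases "K = {}")
      case False
      then have "card K < card (\<Union>(A ` K))" using 3(2)[of K] K i by blast
      moreover have "(\<Union>j\<in>K. A j - {x}) = \<Union>(A ` K) - {x}" by auto
      moreover have "card (\<Union>(A ` K)) \<le> Suc (card (\<Union>(A ` K) - {x}))"
        using diff_card_le_card_Diff[of "{x}" "\<Union>(A ` K)"] by simp
      ultimately show ?thesis by simp
    qed simp
    moreover have "I - {i} \<subset> I" using i by auto
    ultimately obtain h where h: "inj_on h (I - {i})" "\<And>j. j \<in> I - {i} \<Longrightarrow> h j \<in> A j - {x}"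
      using psubset.IH[of "I - {i}" "\<lambda>j. A j - {x}"] finA by fastforce
    have "inj_on (h(i := x)) I"
      using h by (auto simp: inj_on_def)
    moreover have "\<forall>j\<in>I. (h(i := x)) j \<in> A j" using h x by auto
    ultimately show ?thesis by blast
  qed
qed

section \<open>Signs of reorderings and joins of chains with a vertex\<close>

lemma permute_list_Cons:
  assumes "p permutes {..<length xs}"
  obtains q where "q permutes {..<length (x # xs)}" "sign q = sign p"
    "permute_list q (x # xs) = x # permute_list p xs"
proof
  define n where "n = length xs"
  \<comment> \<open>This is \<open>p\<close> shifted up by one position, so that index 0 is
    fixed.\<close>
  let ?q = "map_permutation {..<n} Suc p"
  have p: "p permutes {..<n}" using assms by (simp add: n_def)
  have "?q permutes {1..<Suc n}"
    by (rule map_permutation_permutes[OF _ p])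
      (simp add: bij_betw_def lessThan_atLeast0)
  then show q: "?q permutes {..<length (x # xs)}"
    by (rule permutes_subset) (auto simp: n_def)
  show "sign ?q = sign p" using p by (intro sign_map_permutation) auto
  have 0: "?q 0 = 0"
    using permutes_not_in[OF \<open>?q permutes {1..<Suc n}\<close>] by simp
  have S: "?q (Suc i) = Suc (p i)" if "i < n" for i
    using that by (intro map_permutation_apply) auto
  show "permute_list ?q (x # xs) = x # permute_list p xs"
  proof (rule nth_equalityI)
    fix i assume "i < length (permute_list ?q (x # xs))"
    then show "permute_list ?q (x # xs) ! i = (x # permute_list p xs) ! i"
      using q p 0 S by (cases i) (auto simp: permute_list_nth n_def)
  qed simp
qed

text \<open>Makes the sign of a reordering of a distinct list well defined.\<close>

lemma permute_list_inject:
  assumes "distinct xs" "p permutes {..<length xs}" "q permutes {..<length xs}"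
    and "permute_list p xs = permute_list q xs"
  shows "p = q"
proof
  fix i
  show "p i = q i"
  proof (cases "i < length xs")
    case True
    then have "xs ! p i = xs ! q i"
      by (metis assms(2-4) permute_list_nth)
    then show ?thesis
      using True assms(1) permutes_in_image[OF assms(2)] permutes_in_image[OF assms(3)]
      by (simp add: nth_eq_iff_index_eq)
  next
    case False
    then show ?thesis using assms(2,3) by (simp add: permutes_not_in)
  qed
qed

lemma permute_list_to_front:
  assumes "v \<in> set xs"
  obtains p ys where "p permutes {..<length xs}" "permute_list p xs = v # ys"
proof -
  have "mset (v # remove1 v xs) = mset xs" using assms by simp
  then show thesis by (rule mset_eq_permutation) (rule that)
qed

text \<open>The sign clause of \<open>oriented_chains\<close>, separated from the condition on
  supports.\<close>

definition alternating :: "('a list \<Rightarrow> 'k::field) \<Rightarrow> bool" where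
  "alternating c \<longleftrightarrow>
     (\<forall>xs p. p permutes {..<length xs} \<longrightarrow> c (permute_list p xs) = of_int (sign p) * c xs)"

text \<open>
  The join of a chain with \<open>v\<close>: move \<open>v\<close> to the front by any permutation \<open>p\<close>, then drop it. The
  value does not depend on \<open>p\<close> when \<open>z\<close> is alternating.
\<close>

definition cone_chain :: "'a \<Rightarrow> ('a list \<Rightarrow> 'k::field) \<Rightarrow> 'a list \<Rightarrow> 'k" where
  "cone_chain v z xs =
     (if distinct xs \<and> v \<in> set xs
      then let p = SOME p. p permutes {..<length xs} \<and> hd (permute_list p xs) = v
           in of_int (sign p) * z (tl (permute_list p xs))
      else 0)"

lemma sign_mult_sign [simp]: "of_int (sign p) * (of_int (sign p) * x) = (x :: 'k::field)"
  by (cases p rule: sign_cases) simp_all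

text \<open>The permutation \<open>q\<close> picked by \<open>SOME\<close> and the given
  \<open>p\<close> both bring \<open>v\<close> to the front, leaving tails that differ by some
  \<open>r\<close>. Reordering by \<open>q\<close> is reordering by \<open>p\<close> and then by the
  shifted \<open>r\<close>, so \<open>sign r\<close> enters once through \<open>q\<close> and once
  through \<open>z\<close>, and cancels.\<close>

lemma cone_chain_eq:
  assumes z: "alternating z" and xs: "distinct xs"
    and p: "p permutes {..<length xs}" "permute_list p xs = v # ys"
  shows "cone_chain v z xs = of_int (sign p) * z ys"
proof -
  have v: "v \<in> set xs" using p set_permute_list by (metis list.set_intros(1))
  define q where "q = (SOME p. p permutes {..<length xs} \<and> hd (permute_list p xs) = v)"
  have q: "q permutes {..<length xs}" "hd (permute_list q xs) = v"
    using someI[of "\<lambda>p. p permutes {..<length xs} \<and> hd (permute_list p xs) = v" p] p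
    by (simp_all add: q_def)
  obtain zs where zs: "permute_list q xs = v # zs"
    using q v by (metis length_permute_list length_pos_if_in_set list.exhaust_sel list.size(3) less_irrefl)
  have "mset (v # ys) = mset (v # zs)" using p q zs by (metis mset_permute_list)
  then obtain r where r: "r permutes {..<length ys}" "permute_list r ys = zs"
    using mset_eq_permutation[of zs ys] by auto
  obtain s where s: "s permutes {..<length (v # ys)}" "sign s = sign r"
    "permute_list s (v # ys) = v # zs"
    using permute_list_Cons[OF r(1), of v] r(2) by metis
  have len: "length (v # ys) = length xs" using p(2) by (metis length_permute_list)
  have "permute_list (p \<circ> s) xs = permute_list q xs"
    using s len p zs by (simp add: permute_list_compose)
  then have "q = p \<circ> s"
    using permute_list_inject[OF xs _ q(1)] permutes_compose s(1) p(1) len by metis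
  moreover have "permutation p" "permutation s"
    using p s permutation_permutes by blast+
  ultimately have "sign q = sign p * sign r" using s by (simp add: sign_compose)
  moreover have "z zs = of_int (sign r) * z ys" using z r by (auto simp: alternating_def)
  ultimately show ?thesis
    using xs v zs by (simp add: cone_chain_def mult.assoc flip: q_def)
qed

text \<open>If \<open>q\<close> brings \<open>v\<close> to the front of \<open>xs\<close>, then
  \<open>inv p \<circ> q\<close> brings it to the front of \<open>permute_list p xs\<close> with the
  same tail, and the signs multiply.\<close>

lemma alternating_cone_chain:
  assumes z: "alternating z"
  shows "alternating (cone_chain v z)"
  unfolding alternating_def
proof (intro allI impI)
  fix xs p assume p: "p permutes {..<length (xs :: 'a list)}"
  show "cone_chain v z (permute_list p xs) = of_int (sign p) * cone_chain v z xs"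
  proof (cases "distinct xs \<and> v \<in> set xs")
    case False
    then show ?thesis using p by (auto simp: cone_chain_def)
  next
    case True
    then obtain q ys where q: "q permutes {..<length xs}" "permute_list q xs = v # ys"
      using permute_list_to_front by metis
    define r where "r = inv p \<circ> q"
    have r: "r permutes {..<length xs}"
      unfolding r_def by (intro permutes_compose permutes_inv p q)
    have "p \<circ> r = q" unfolding r_def using permutes_inv_o(1)[OF p] by (simp add: o_assoc)
    then have "permute_list r (permute_list p xs) = v # ys"
      using permute_list_compose[OF r, of p] q by simp
    then have "cone_chain v z (permute_list p xs) = of_int (sign r) * z ys"
      using True p r by (intro cone_chain_eq z) auto
    moreover have "cone_chain v z xs = of_int (sign q) * z ys"
      using True q by (intro cone_chain_eq z) auto
    moreover have "permutation p" "permutation q"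
      using p q permutation_permutes by blast+
    then have "sign r = sign p * sign q"
      by (simp add: r_def sign_compose sign_inverse permutation_inverse)
    ultimately show ?thesis by simp
  qed
qed

section \<open>Acyclicity of cones\<close>

text \<open>Joining with the apex is a contracting homotopy: the boundary of the join of
  \<open>v\<close> with \<open>z\<close> is \<open>z\<close> minus the join of \<open>v\<close> with
  the boundary of \<open>z\<close>, and the latter vanishes on cycles.\<close>

lemma cone_acyclic:
  fixes K :: "'a set set"
  assumes fin: "finite (vertices K)" and v: "v \<in> vertices K"
    and cone: "\<And>\<tau>. \<tau> \<in> K \<Longrightarrow> insert v \<tau> \<in> K"
  shows "(cycles K i :: ('a list \<Rightarrow> 'k::field) set) \<subseteq> boundaries K i"
proof
  fix z :: "'a list \<Rightarrow> 'k"
  assume "z \<in> cycles K i"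
  then have z: "alternating z" "\<And>xs. z xs \<noteq> 0 \<Longrightarrow> distinct xs \<and> set xs \<in> K \<and> int (length xs) = i + 1"
    and bd: "\<And>ys. (\<Sum>x\<in>vertices K. z (x # ys)) = 0"
    by (auto simp: cycles_def oriented_chains_def boundary_def alternating_def fun_eq_iff)
  \<comment> \<open>The join lives on \<open>K\<close> since \<open>K\<close> is closed under
    inserting the apex; \<open>v\<close> adds one vertex and so raises the degree by one.\<close>
  have "cone_chain v z \<in> oriented_chains K (i + 1)"
  proof -
    have "set xs \<in> K \<and> int (length xs) = i + 2"
      if nz: "cone_chain v z xs \<noteq> 0" for xs
    proof -
      have d: "distinct xs" "v \<in> set xs" using nz by (auto simp: cone_chain_def split: if_splits)
      then obtain q ys where q: "q permutes {..<length xs}" "permute_list q xs = v # ys"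
        using permute_list_to_front by metis
      then have "z ys \<noteq> 0" using nz cone_chain_eq[OF z(1) d(1) q] by auto
      then have "insert v (set ys) \<in> K" "int (length ys) = i + 1" using z cone by auto
      moreover have "set xs = insert v (set ys)" using set_permute_list[OF q(1)] q(2) by simp
      moreover have "length xs = Suc (length ys)" using length_permute_list[of q xs] q(2) by simp
      ultimately show ?thesis by simp
    qed
    moreover have "distinct xs" if "cone_chain v z xs \<noteq> 0" for xs
      using that by (auto simp: cone_chain_def split: if_splits)
    ultimately show ?thesis
      using alternating_cone_chain[OF z(1)]
      by (auto simp: oriented_chains_def alternating_def)
  qed
  moreover have "boundary K (cone_chain v z) ys = z ys" for ys
  proof (cases "distinct ys")
    case False
    then show ?thesis using z(2)[of ys] by (auto simp: boundary_def cone_chain_def)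
  next
    case d: True
    show ?thesis
    proof (cases "v \<in> set ys")
      case False
      \<comment> \<open>Only the summand \<open>x = v\<close> contributes, since the other lists
        miss \<open>v\<close>.\<close>
      have "cone_chain v z (v # ys) = z ys"
        using cone_chain_eq[OF z(1), of "v # ys" id v ys] d False by (simp add: permutes_id)
      moreover have "(\<Sum>x\<in>vertices K - {v}. cone_chain v z (x # ys)) = 0"
        using False by (intro sum.neutral) (auto simp: cone_chain_def)
      ultimately show ?thesis by (simp add: boundary_def sum.remove[OF fin v])
    next
      case True
      then obtain p l where p: "p permutes {..<length ys}" "permute_list p ys = v # l"
        using permute_list_to_front by metis
      have set: "set ys = insert v (set l)" using set_permute_list[OF p(1)] p(2) by simp
      \<comment> \<open>Compared with \<open>p\<close>, bringing \<open>v\<close> to the front of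
        \<open>x # ys\<close> takes one further transposition, past \<open>x\<close>; this gives the
        minus sign. If \<open>x\<close> is already in \<open>ys\<close>, both sides vanish because a
        vertex is repeated.\<close>
      have "cone_chain v z (x # ys) = - (of_int (sign p) * z (x # l))" if "x \<noteq> v" for x
      proof (cases "x \<in> set ys")
        case True
        then have "z (x # l) = 0" using z(2)[of "x # l"] set that by auto
        then show ?thesis using True by (simp add: cone_chain_def)
      next
        case False
        obtain q where q: "q permutes {..<length (x # ys)}" "sign q = sign p"
          "permute_list q (x # ys) = x # v # l"
          using permute_list_Cons[OF p(1), of x] p(2) by metis
        let ?t = "transpose 0 (Suc 0)"
        have len: "length ys = Suc (length l)"
          using length_permute_list[of p ys] p(2) by simp
        have t: "?t permutes {..<length (x # ys)}"
          using len by (intro permutes_swap_id) auto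
        have "permute_list ?t (x # v # l) = v # x # l"
          by (rule nth_equalityI)
            (use t len in \<open>auto simp: permute_list_nth nth_Cons transpose_def split: nat.splits\<close>)
        then have "permute_list (q \<circ> ?t) (x # ys) = v # x # l"
          using permute_list_compose[OF t, of q] q(3) by simp
        moreover have "sign (q \<circ> ?t) = - sign p"
          using q permutation_permutes[of q] by (subst sign_compose) (auto simp: sign_swap_id permutation_swap_id)
        moreover have "(q \<circ> ?t) permutes {..<length (x # ys)}"
          using t q(1) by (rule permutes_compose)
        ultimately show ?thesis
          using cone_chain_eq[OF z(1), of "x # ys" "q \<circ> ?t"] d False by simp
      qed
      moreover have "cone_chain v z (v # ys) = 0" using True by (simp add: cone_chain_def)
      ultimately have "boundary K (cone_chain v z) ys
          = - (of_int (sign p) * (\<Sum>x\<in>vertices K - {v}. z (x # l)))"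
        by (simp add: boundary_def sum.remove[OF fin v] sum_distrib_left sum_negf)
      \<comment> \<open>The cycle condition at \<open>l\<close> turns the sum over the other
        vertices into minus the summand at \<open>v\<close>.\<close>
      also have "(\<Sum>x\<in>vertices K - {v}. z (x # l)) = - z (v # l)"
        using bd[of l] by (simp add: sum.remove[OF fin v] add_eq_0_iff)
      also have "z (v # l) = of_int (sign p) * z ys"
        using z(1) p by (metis alternating_def)
      finally show ?thesis by simp
    qed
  qed
  then have "boundary K (cone_chain v z) = z" by auto
  ultimately show "z \<in> boundaries K i" unfolding boundaries_def
    by (metis (no_types, lifting) imageI)
qed

text \<open>Over a cone all cycles are boundaries, so there is a single homology class, whereas the
  field has the distinct elements 0 and 1.\<close>

lemma sphere_not_cone:
  fixes K :: "'a set set"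
  assumes iso: "homology_iso_field TYPE('k::field) K i"
    and fin: "finite (vertices K)" and v: "v \<in> vertices K"
  obtains \<tau> where "\<tau> \<in> K" "insert v \<tau> \<notin> K"
proof (rule ccontr)
  assume "\<not> thesis"
  then have cone: "(cycles K i :: ('a list \<Rightarrow> 'k) set) \<subseteq> boundaries K i"
    using that by (intro cone_acyclic[OF fin v]) blast
  have sub: "(\<lambda>xs. w xs - z xs) \<in> cycles K i"
    if "w \<in> cycles K i" "z \<in> cycles K i" for w z :: "'a list \<Rightarrow> 'k"
    using that
    by (auto simp: cycles_def oriented_chains_def boundary_def fun_eq_iff sum_subtractf
        right_diff_distrib) metis+
  \<comment> \<open>Any two cycles differ by a cycle, hence by a boundary, so every class is all of
    \<open>cycles K i\<close>.\<close>
  have "homology_class K i z = cycles K i" if "z \<in> cycles K i" for z :: "'a list \<Rightarrow> 'k"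
    using sub[OF _ that] cone by (auto simp: homology_class_def)
  then have "(reduced_homology K i :: ('a list \<Rightarrow> 'k) set set) \<subseteq> {cycles K i}"
    by (auto simp: reduced_homology_def)
  moreover obtain \<phi> :: "('a list \<Rightarrow> 'k) set \<Rightarrow> 'k"
    where "bij_betw \<phi> (reduced_homology K i) UNIV"
    using iso by (auto simp: homology_iso_field_def)
  then have "\<phi> ` reduced_homology K i = UNIV" by (simp add: bij_betw_def)
  ultimately have "c = \<phi> (cycles K i)" for c by blast
  then have "(0 :: 'k) = 1" by metis
  then show False by simp
qed

section \<open>Neighbours of faces in the complement graph\<close>

text \<open>The link of \<open>\<sigma>\<close> is not a cone with apex \<open>v\<close>, so some
  \<open>\<tau>\<close> in it cannot be extended by \<open>v\<close> within the link. By flagness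
  this failure is a missing edge, and \<open>w\<close> is its endpoint in \<open>\<tau>\<close>;
  lying in the link, \<open>w\<close> is adjacent in the skeleton to all of
  \<open>\<sigma>\<close>.\<close>

lemma flag_sphere_non_neighbour:
  fixes \<Delta> :: "'a set set"
  assumes sc: "simplicial_complex \<Delta>" and flag: "flag \<Delta>"
    and sph: "homology_sphere TYPE('k::field) \<Delta>"
    and \<sigma>: "insert v \<sigma> \<in> \<Delta>" "v \<notin> \<sigma>"
  obtains w where "w \<in> vertices \<Delta>" "w \<noteq> v" "{v, w} \<notin> skeleton_edges \<Delta>"
    "\<And>u. u \<in> \<sigma> \<Longrightarrow> u \<noteq> w \<and> {u, w} \<in> skeleton_edges \<Delta>"
proof -
  let ?V = "vertices \<Delta>" and ?E = "skeleton_edges \<Delta>"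
  have sub: "\<rho> \<in> \<Delta>" if "\<tau> \<in> \<Delta>" "\<rho> \<subseteq> \<tau>" for \<rho> \<tau>
    using sc that by (auto simp: simplicial_complex_def)
  have mem: "\<tau> \<in> \<Delta> \<longleftrightarrow> clique ?V ?E \<tau>" for \<tau>
    using flag unfolding flag_def by blast
  have \<sigma>\<Delta>: "\<sigma> \<in> \<Delta>" using sub[OF \<sigma>(1)] by blast
  have "homology_iso_field TYPE('k) (link \<Delta> \<sigma>) (complex_dim \<Delta> - int (card \<sigma>))"
    using sph \<sigma>\<Delta> by (auto simp: homology_sphere_def)
  moreover have "finite (vertices (link \<Delta> \<sigma>))"
    using sc by (auto simp: simplicial_complex_def vertices_def link_def)
  moreover have "{v} \<in> link \<Delta> \<sigma>"
    using \<sigma> sub[OF \<sigma>(1), of "{v}"] by (simp add: link_def)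
  then have "v \<in> vertices (link \<Delta> \<sigma>)" by (auto simp: vertices_def)
  ultimately obtain \<tau> where \<tau>: "\<tau> \<in> link \<Delta> \<sigma>" "insert v \<tau> \<notin> link \<Delta> \<sigma>"
    by (rule sphere_not_cone)
  have "insert v \<tau> \<union> \<sigma> \<notin> \<Delta>"
    using \<tau> \<sigma> sub[of "insert v \<tau> \<union> \<sigma>" "insert v \<tau>"] by (auto simp: link_def)
  moreover have \<tau>\<sigma>: "clique ?V ?E (\<tau> \<union> \<sigma>)" "clique ?V ?E (insert v \<sigma>)" "\<tau> \<inter> \<sigma> = {}"
    using \<tau> \<sigma> mem by (auto simp: link_def)
  \<comment> \<open>The cliques \<open>\<tau> \<union> \<sigma>\<close> and
    \<open>insert v \<sigma>\<close> account for every pair in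
    \<open>insert v \<tau> \<union> \<sigma>\<close> except those of \<open>v\<close> with a vertex
    of \<open>\<tau>\<close>.\<close>
  ultimately obtain w where "w \<in> \<tau>" "w \<noteq> v" "{v, w} \<notin> ?E"
    unfolding mem clique_def by (auto simp: insert_commute)
  moreover have "u \<noteq> w \<and> {u, w} \<in> ?E" if "u \<in> \<sigma>" for u
  proof -
    have "u \<noteq> w" using that \<tau>\<sigma>(3) \<open>w \<in> \<tau>\<close> by blast
    then show ?thesis using that \<tau>\<sigma>(1) \<open>w \<in> \<tau>\<close> unfolding clique_def by blast
  qed
  ultimately show thesis
    using \<tau>\<sigma>(1) by (intro that[of w]) (auto simp: clique_def)
qed

text \<open>Building the face one vertex at a time, each new \<open>v\<close> brings the
  \<open>w\<close> of \<open>flag_sphere_non_neighbour\<close>, a neighbour of \<open>v\<close> in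
  the complement but of no earlier vertex.\<close>

lemma face_neighbours:
  fixes \<Delta> :: "'a set set"
  assumes sc: "simplicial_complex \<Delta>" and flag: "flag \<Delta>"
    and sph: "homology_sphere TYPE('k::field) \<Delta>"
    and \<sigma>: "\<sigma> \<in> \<Delta>"
  shows "card \<sigma> \<le> card {w \<in> vertices \<Delta>. \<exists>u\<in>\<sigma>. {u, w} \<in> complement_edges (vertices \<Delta>) (skeleton_edges \<Delta>)}"
    (is "_ \<le> card (?N \<sigma>)")
proof -
  have fin: "finite (vertices \<Delta>)" and "finite \<sigma>"
    using sc \<sigma> by (auto simp: simplicial_complex_def vertices_def)
  from \<open>finite \<sigma>\<close> \<sigma> show ?thesis
  proof (induction \<sigma>)
    case (insert v \<sigma>)
    obtain w where w: "w \<in> vertices \<Delta>" "w \<noteq> v" "{v, w} \<notin> skeleton_edges \<Delta>"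
      "\<And>u. u \<in> \<sigma> \<Longrightarrow> u \<noteq> w \<and> {u, w} \<in> skeleton_edges \<Delta>"
      using flag_sphere_non_neighbour[OF sc flag sph insert.prems insert.hyps(2)] by blast
    have "v \<in> vertices \<Delta>" using insert.prems by (auto simp: vertices_def)
    then have "insert w (?N \<sigma>) \<subseteq> ?N (insert v \<sigma>)"
      using w by (auto simp: complement_edges_def)
    then have "card (insert w (?N \<sigma>)) \<le> card (?N (insert v \<sigma>))"
      using fin by (intro card_mono) auto
    moreover have "w \<notin> ?N \<sigma>" using w by (auto simp: complement_edges_def)
    moreover have "\<sigma> \<in> \<Delta>"
      using sc insert.prems unfolding simplicial_complex_def by blast
    ultimately show ?case using insert fin by simp
  qed simp
qed

section \<open>Permutations along edges from Hall's condition\<close>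

text \<open>Hall's condition for independent sets implies it for all sets, so the neighbourhoods
  have a system of distinct representatives; as an injective self-map of a finite set it is a
  permutation.\<close>

lemma permutation_along_edges:
  assumes fin: "finite V"
    and indep: "\<And>S. S \<subseteq> V \<Longrightarrow> (\<And>u v. u \<in> S \<Longrightarrow> v \<in> S \<Longrightarrow> {u, v} \<notin> E) \<Longrightarrow>
      card S \<le> card {w \<in> V. \<exists>u\<in>S. {u, w} \<in> E}"
  shows "\<exists>\<pi>. \<pi> permutes V \<and> (\<forall>v\<in>V. {v, \<pi> v} \<in> E)"
proof -
  define N where "N u = {w \<in> V. {u, w} \<in> E}" for u
  have N: "\<Union>(N ` S) = {w \<in> V. \<exists>u\<in>S. {u, w} \<in> E}" for S by (auto simp: N_def)
  have "card S \<le> card (\<Union>(N ` S))" if S: "S \<subseteq> V" for S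
  proof -
    \<comment> \<open>The isolated vertices of the subgraph induced on \<open>S\<close>; they form
      an independent set.\<close>
    define I where "I = {u \<in> S. \<forall>w\<in>S. {u, w} \<notin> E}"
    have finS: "finite S" using S fin finite_subset by blast
    have finN: "finite (\<Union>(N ` T))" for T using fin by (simp add: N)
    \<comment> \<open>The vertices of \<open>S - I\<close> are themselves neighbours of \<open>S\<close>, and none is a neighbour of \<open>I\<close>.\<close>
    have "card S = card I + card (S - I)"
      using finS by (subst card_Un_disjoint[symmetric]) (auto simp: I_def intro!: arg_cong[of _ _ card])
    also have "card I \<le> card (\<Union>(N ` I))"
      unfolding N using S by (intro indep) (auto simp: I_def)
    also have "card (\<Union>(N ` I)) + card (S - I) = card (\<Union>(N ` I) \<union> (S - I))"
      using finS finN by (subst card_Un_disjoint) (auto simp: I_def N_def)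
    also have "\<dots> \<le> card (\<Union>(N ` S))"
      using S finN by (intro card_mono) (auto simp: I_def N_def insert_commute)
    finally show ?thesis by simp
  qed
  then obtain f where f: "inj_on f V" "\<And>v. v \<in> V \<Longrightarrow> f v \<in> N v"
    using hall_marriage[of V N] fin by (auto simp: N_def)
  define \<pi> where "\<pi> v = (if v \<in> V then f v else v)" for v
  have "inj_on \<pi> V" using f(1) by (simp add: inj_on_def \<pi>_def)
  moreover have "\<pi> ` V \<subseteq> V" using f(2) by (auto simp: \<pi>_def N_def)
  ultimately have "bij_betw \<pi> V V"
    using fin by (simp add: bij_betw_def endo_inj_surj)
  then have "\<pi> permutes V" by (rule bij_imp_permutes) (simp add: \<pi>_def)
  moreover have "\<forall>v\<in>V. {v, \<pi> v} \<in> E" using f(2) by (auto simp: \<pi>_def N_def)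
  ultimately show ?thesis by blast
qed

section \<open>Half-integral matchings and odd cycles from a permutation\<close>

text \<open>Exactly two steps of \<open>\<pi>\<close> touch a vertex, one leaving and one entering
  it, each weighing 1/2. An edge carries at most two steps, one from each end.\<close>

lemma half_integral_from_permutation:
  assumes fin: "finite V" and \<pi>: "\<pi> permutes V"
    and edge: "\<And>v. v \<in> V \<Longrightarrow> {v, \<pi> v} \<in> E" and two: "\<And>e. e \<in> E \<Longrightarrow> e \<subseteq> V \<and> card e = 2"
  shows "half_integral_perfect_matching V E (\<lambda>e. card {v \<in> V. {v, \<pi> v} = e} / 2)"
proof -
  have finE: "finite E" using two fin by (intro finite_subset[of E "Pow V"]) auto
  have "card {v \<in> V. {v, \<pi> v} = e} \<le> 2" if "e \<in> E" for e
  proof -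
    have "card e = 2" using two that by blast
    moreover have "card {v \<in> V. {v, \<pi> v} = e} \<le> card e"
      using \<open>card e = 2\<close> by (intro card_mono) (auto intro: card_ge_0_finite)
    ultimately show ?thesis by simp
  qed
  then have "card {v \<in> V. {v, \<pi> v} = e} \<in> {0, 1, 2}" if "e \<in> E" for e
    using that by fastforce
  then have "card {v \<in> V. {v, \<pi> v} = e} / 2 \<in> {0, 1 / 2, 1 :: real}" if "e \<in> E" for e
    using that by fastforce
  moreover have "(\<Sum>e\<in>{e \<in> E. v \<in> e}. card {u \<in> V. {u, \<pi> u} = e} / 2) = (1 :: real)"
    if v: "v \<in> V" for v
  proof -
    \<comment> \<open>A fixed point would give a one-element edge.\<close>
    have ne: "\<pi> u \<noteq> u" if "u \<in> V" for u using edge[OF that] two by force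
    obtain u where u: "u \<in> V" "\<pi> u = v"
      using v permutes_image[OF \<pi>] by (metis imageE)
    \<comment> \<open>Steps along edges at \<open>v\<close> start at \<open>v\<close> or at its
      preimage \<open>u\<close>; these differ, so they count as two even when both use the same
      edge.\<close>
    have "(\<Sum>e\<in>{e \<in> E. v \<in> e}. card {u \<in> V. {u, \<pi> u} = e})
        = card (\<Union>e\<in>{e \<in> E. v \<in> e}. {u \<in> V. {u, \<pi> u} = e})"
      using finE fin by (subst card_UN_disjoint) auto
    also have "(\<Union>e\<in>{e \<in> E. v \<in> e}. {u \<in> V. {u, \<pi> u} = e}) = {u, v}"
      using u v edge permutes_inj[OF \<pi>] by (auto dest: injD)
    also have "card {u, v} = 2" using u ne[of u] by (metis card_2_iff)
    finally show ?thesis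
      by (simp flip: sum_divide_distrib of_nat_sum)
  qed
  ultimately show ?thesis
    unfolding half_integral_perfect_matching_def by blast
qed


text \<open>Allows each orbit of a permutation to be treated separately. Pieces from different
  blocks are disjoint because the blocks are.\<close>

lemma matching_odd_cycle_partition_UN:
  assumes P: "partition_on V P"
    and B: "\<And>B. B \<in> P \<Longrightarrow> matching_odd_cycle_partition B E (M B) (C B)"
  shows "matching_odd_cycle_partition V E (\<Union>B\<in>P. M B) (\<Union>B\<in>P. C B)"
proof -
  have part: "partition_on B (M B \<union> C B)" if "B \<in> P" for B
    using B that by (auto simp: matching_odd_cycle_partition_def)
  have U: "\<Union>(M B \<union> C B) = B" if "B \<in> P" for B
    using partition_onD1[OF part[OF that]] by (rule sym)
  have "disjoint (\<Union>B\<in>P. M B \<union> C B)"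
    using part partition_onD2[OF P]
    by (intro disjoint_UN) (auto simp: partition_on_def disjoint_family_on_def disjoint_def U)
  moreover have "\<Union>(\<Union>B\<in>P. M B \<union> C B) = V"
    using U partition_onD1[OF P] by blast
  moreover have "{} \<notin> (\<Union>B\<in>P. M B \<union> C B)"
    using part partition_onD3 by blast
  moreover have eq: "(\<Union>B\<in>P. M B \<union> C B) = (\<Union>B\<in>P. M B) \<union> (\<Union>B\<in>P. C B)" by blast
  ultimately have p: "partition_on V ((\<Union>B\<in>P. M B) \<union> (\<Union>B\<in>P. C B))"
    by (simp only: partition_on_def simp_thms)
  then have "disjoint (\<Union>B\<in>P. M B)"
    using partition_onD2 disjoint_unionD1 by blast
  then show ?thesis
    using p B unfolding matching_odd_cycle_partition_def matching_def by blast
qed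

text \<open>An odd list is itself an odd cycle; an even one splits into every other edge, which also
  covers length 2, where the walk runs back and forth on one edge.\<close>

lemma closed_walk_matching_odd_cycle_partition:
  assumes d: "distinct xs" and ne: "xs \<noteq> []"
    and edge: "\<And>i. i < length xs \<Longrightarrow> {xs ! i, xs ! (Suc i mod length xs)} \<in> E"
    and two: "\<And>e. e \<in> E \<Longrightarrow> card e = 2"
  shows "\<exists>M C. matching_odd_cycle_partition (set xs) E M C"
proof (cases "odd (length xs)")
  case True
  \<comment> \<open>In length 1 the wrap-around would give a one-element edge.\<close>
  have "length xs \<noteq> 1" using edge[of 0] two by fastforce
  moreover have "length xs \<noteq> 2" using True by auto
  ultimately have "length xs \<ge> 3" using ne by (cases xs) (auto simp: numeral_eq_Suc Suc_le_eq neq_Nil_conv)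
  then have "graph_cycle E xs" using d edge by (simp add: graph_cycle_def)
  then have "matching_odd_cycle_partition (set xs) E {} {set xs}"
    using True ne partition_on_space[of "set xs"]
    by (auto simp: matching_odd_cycle_partition_def matching_def)
  then show ?thesis by blast
next
  case False
  then obtain n where n: "length xs = 2 * n" by (auto elim: evenE)
  \<comment> \<open>The edge leaving position \<open>2 * i\<close>; as the length is even, its end
    \<open>Suc (2 * i)\<close> never wraps around.\<close>
  define F where "F i = {xs ! (2 * i), xs ! Suc (2 * i)}" for i
  have FE: "F i \<in> E" if "i < n" for i
    using edge[of "2 * i"] that n by (simp add: F_def)
  have "disjoint_family_on F {..<n}"
  proof (unfold disjoint_family_on_def, intro ballI impI)
    fix i j assume "i \<in> {..<n}" "j \<in> {..<n}" "i \<noteq> j"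
    moreover from this have "2 * i \<noteq> Suc (2 * j)" "2 * j \<noteq> Suc (2 * i)" by presburger+
    ultimately show "F i \<inter> F j = {}"
      using d n by (auto simp: F_def nth_eq_iff_index_eq)
  qed
  then have dis: "disjoint (F ` {..<n})" by (rule disjoint_family_on_disjoint_image)
  have "\<Union>(F ` {..<n}) = set xs"
  proof
    show "\<Union>(F ` {..<n}) \<subseteq> set xs" using n by (auto simp: F_def)
    show "set xs \<subseteq> \<Union>(F ` {..<n})"
    proof
      fix x assume "x \<in> set xs"
      then obtain k where k: "k < 2 * n" "x = xs ! k" using n by (auto simp: in_set_conv_nth)
      then have "x \<in> F (k div 2)" by (cases "even k") (auto simp: F_def elim: oddE)
      then show "x \<in> \<Union>(F ` {..<n})" using k by auto
    qed
  qed
  then have "partition_on (set xs) (F ` {..<n})"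
    using dis by (auto simp: partition_on_def F_def)
  then have "matching_odd_cycle_partition (set xs) E (F ` {..<n}) {}"
    using dis FE by (auto simp: matching_odd_cycle_partition_def matching_def)
  then show ?thesis by blast
qed

text \<open>The orbits of \<open>\<pi>\<close> partition \<open>V\<close>, and each one, listed in
  the order of iteration, is a closed walk along edges.\<close>

lemma matching_odd_cycle_partition_from_permutation:
  assumes fin: "finite V" and \<pi>: "\<pi> permutes V"
    and edge: "\<And>v. v \<in> V \<Longrightarrow> {v, \<pi> v} \<in> E" and two: "\<And>e. e \<in> E \<Longrightarrow> card e = 2"
  shows "\<exists>M C. matching_odd_cycle_partition V E M C"
proof -
  have perm: "permutation \<pi>" using \<pi> fin permutation_permutes by blast
  \<comment> \<open>\<open>support \<pi> v\<close> lists \<open>v\<close>, \<open>\<pi> v\<close>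
    and so on, stopping just before the first return to \<open>v\<close>.\<close>
  define orb where "orb v = set (support \<pi> v)" for v
  have orbV: "orb v \<subseteq> V" if "v \<in> V" for v
    using that permutes_in_image[OF permutes_funpow[OF \<pi>]] by (auto simp: orb_def)
  have self: "v \<in> orb v" for v
    unfolding orb_def support_set[OF perm] by (metis funpow_0 rangeI)
  have "disjoint (orb ` V)"
    using disjoint_support[OF perm] unfolding orb_def disjoint_def by blast
  moreover have "\<Union>(orb ` V) = V" using orbV self by blast
  moreover have "{} \<notin> orb ` V" using self by blast
  ultimately have part: "partition_on V (orb ` V)" by (simp add: partition_on_def)
  have "\<exists>M C. matching_odd_cycle_partition B E M C" if B: "B \<in> orb ` V" for B
  proof -
    obtain v where v: "v \<in> V" "B = orb v" using B by blast
    define n where "n = least_power \<pi> v"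
    have n: "(\<pi> ^^ n) v = v" "n > 0"
      using least_power_of_permutation[OF perm] by (auto simp: n_def)
    have len: "length (support \<pi> v) = n" by (simp add: n_def)
    have nth: "support \<pi> v ! i = (\<pi> ^^ i) v" if "i < n" for i
      using that by (simp add: n_def)
    have "{support \<pi> v ! i, support \<pi> v ! (Suc i mod n)} \<in> E" if i: "i < n" for i
    proof -
      \<comment> \<open>At the last position the index wraps to 0, in accordance with the return
        \<open>(\<pi> ^^ n) v = v\<close>.\<close>
      have "support \<pi> v ! (Suc i mod n) = \<pi> ((\<pi> ^^ i) v)"
        using n i by (cases "Suc i = n") (auto simp: nth)
      moreover have "(\<pi> ^^ i) v \<in> V" using v permutes_in_image[OF permutes_funpow[OF \<pi>]] by blast
      ultimately show ?thesis using edge nth i by simp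
    qed
    moreover have "distinct (support \<pi> v)" using perm by (rule cycle_of_permutation)
    moreover have "support \<pi> v \<noteq> []" using n(2) len by auto
    ultimately show ?thesis
      unfolding v(2) orb_def using two len
      by (intro closed_walk_matching_odd_cycle_partition) auto
  qed
  then obtain M C where "\<And>B. B \<in> orb ` V \<Longrightarrow> matching_odd_cycle_partition B E (M B) (C B)"
    by metis
  then show ?thesis using matching_odd_cycle_partition_UN[OF part] by blast
qed

theorem theorem1p7:
  fixes \<Delta> :: "'a set set"
  assumes "simplicial_complex \<Delta>"
    and "flag \<Delta>"
    and "homology_sphere TYPE('k::field) \<Delta>"
  shows "(\<exists>f. half_integral_perfect_matching (vertices \<Delta>)
               (complement_edges (vertices \<Delta>) (skeleton_edges \<Delta>)) f) \<and>
         (\<exists>M C. matching_odd_cycle_partition (vertices \<Delta>)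
               (complement_edges (vertices \<Delta>) (skeleton_edges \<Delta>)) M C)"
proof -
  let ?V = "vertices \<Delta>" and ?S = "skeleton_edges \<Delta>"
  let ?E = "complement_edges ?V ?S"
  have fin: "finite ?V"
    using assms(1) by (auto simp: simplicial_complex_def vertices_def)
  have two: "e \<subseteq> ?V \<and> card e = 2" if "e \<in> ?E" for e
    using that by (simp add: complement_edges_def)
  \<comment> \<open>An independent set of the complement graph is a clique of the skeleton, hence a
    face by flagness.\<close>
  have indep: "S \<in> \<Delta>" if "S \<subseteq> ?V" "\<And>u v. u \<in> S \<Longrightarrow> v \<in> S \<Longrightarrow> {u, v} \<notin> ?E" for S
  proof -
    have "clique ?V ?S S"
      using that by (auto simp: clique_def complement_edges_def subset_iff)
    then show ?thesis using assms(2) unfolding flag_def by blast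
  qed
  have hall: "card S \<le> card {w \<in> ?V. \<exists>u\<in>S. {u, w} \<in> ?E}"
    if "S \<subseteq> ?V" "\<And>u v. u \<in> S \<Longrightarrow> v \<in> S \<Longrightarrow> {u, v} \<notin> ?E" for S
    using face_neighbours[OF assms indep[OF that]] .
  obtain \<pi> where \<pi>: "\<pi> permutes ?V" "\<And>v. v \<in> ?V \<Longrightarrow> {v, \<pi> v} \<in> ?E"
    using permutation_along_edges[OF fin hall] by auto
  have "half_integral_perfect_matching ?V ?E (\<lambda>e. card {v \<in> ?V. {v, \<pi> v} = e} / 2)"
    by (rule half_integral_from_permutation[OF fin \<pi> two])
  moreover have "\<exists>M C. matching_odd_cycle_partition ?V ?E M C"
    by (rule matching_odd_cycle_partition_from_permutation[OF fin \<pi> two[THEN conjunct2]])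
  ultimately show ?thesis by blast
qed

end
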